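(* Let $(X,T)$ be a dynamical system and $n\geq 2$. Then $(X,T)$ is $n$-tuplewise IP-sensitive if and only if there exists a constant $\delta>0$ with the property that for every non-empty open subset $U$ of $X$ there exist $x_1,\dots,x_n\in U$ and $y_1,\dots,y_n\in X$ such that $\min_{1\le i<j\le n}d(y_i,y_j)\geq\delta$ and $(x_1,\dots,x_n)$ is strongly proximal to $(y_1,\dots,y_n)$ in the $n$-fold product system $(X^n,T^{(n)})$.
   Context: A dynamical system is a pair $(X,T)$ where $X$ is a compact metric space with metric $d$ and $T\colon X\to X$ is a continuous surjection. $\mathbb{N}$ is the set of positive integers. The $n$-fold product system is $(X^n,T^{(n)})$ with $T^{(n)}(x_1,\dots,x_n)=(Tx_1,\dots,Tx_n)$. For a point $x$, $\omega(x,T)$ denotes the set of limit points of the sequence $(T^kx)_{k\ge 1}$, i.e. of all limits of $T^{k_i}x$ with $k_i\to\infty$. In a system $(X,T)$, $x$ is strongly proximal to $y$ if $(y,y)\in\omega((x,y),T\times T)$; this definition is applied to the system $(X^n,T^{(n)})$. A set $F\subset\mathbb{N}$ is an IP-set if there is a sequence $(p_i)_{i\ge1}$ in $\mathbb{N}$ such that $\sum_{i\in\alpha}p_i\in F$ for every non-empty finite $\alpha\subset\mathbb{N}$. $(X,T)$ is $n$-tuplewise IP-sensitive if there is a constant $\delta>0$ such that for every non-empty open $U\subset X$ there exist $x_1,\dots,x_n\in U$ such that $\{k\in\mathbb{N}: \min_{1\le i<j\le n}d(T^kx_i,T^kx_j)>\delta\}$ is an IP-set. *)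

theory Defs
  imports "HOL-Analysis.Analysis"
begin

text \<open>
  The phase space is a set \<open>X\<close> with the metric of the ambient type. Behaviour of \<open>T\<close> outside
  \<open>X\<close> is irrelevant.
\<close>

definition dynamical_system :: "'a::metric_space set \<Rightarrow> ('a \<Rightarrow> 'a) \<Rightarrow> bool" where
  "dynamical_system X T \<longleftrightarrow> compact X \<and> continuous_on X T \<and> T ` X = X"

text \<open>
  Notions that are also applied to product systems are defined for a map on an abstract
  topological space, so that they can be used with \<open>prod_topology\<close> and \<open>product_topology\<close>.
  Note that \<open>limitin\<close> includes that the limit lies in the space.
\<close>

definition omega_limit_set :: "'b topology \<Rightarrow> ('b \<Rightarrow> 'b) \<Rightarrow> 'b \<Rightarrow> 'b set" where
  "omega_limit_set Y S x =
     {y. \<exists>k :: nat \<Rightarrow> nat. filterlim k at_top sequentially \<and>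
           limitin Y (\<lambda>i. (S ^^ k i) x) y sequentially}"

definition strongly_proximal :: "'b topology \<Rightarrow> ('b \<Rightarrow> 'b) \<Rightarrow> 'b \<Rightarrow> 'b \<Rightarrow> bool" where
  "strongly_proximal Y S x y \<longleftrightarrow>
     (y, y) \<in> omega_limit_set (prod_topology Y Y) (map_prod S S) (x, y)"

text \<open>
  Points of \<open>X\<^sup>n\<close> are the extensional functions in \<open>{1..n} \<rightarrow>\<^sub>E X\<close>.
\<close>

definition power_space :: "nat \<Rightarrow> 'a::metric_space set \<Rightarrow> (nat \<Rightarrow> 'a) topology" where
  "power_space n X = product_topology (\<lambda>_. top_of_set X) {1..n}"

definition power_map :: "nat \<Rightarrow> ('a \<Rightarrow> 'a) \<Rightarrow> (nat \<Rightarrow> 'a) \<Rightarrow> (nat \<Rightarrow> 'a)" where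
  "power_map n T x = (\<lambda>i\<in>{1..n}. T (x i))"

definition IP_set :: "nat set \<Rightarrow> bool" where
  "IP_set F \<longleftrightarrow> F \<subseteq> {1..} \<and>
     (\<exists>p :: nat \<Rightarrow> nat. (\<forall>i\<ge>1. p i \<ge> 1) \<and>
        (\<forall>\<alpha>. finite \<alpha> \<and> \<alpha> \<noteq> {} \<and> \<alpha> \<subseteq> {1..} \<longrightarrow> (\<Sum>i\<in>\<alpha>. p i) \<in> F))"

text \<open>Only meaningful for \<open>n \<ge> 2\<close>, since otherwise the minimum is over the empty set.\<close>

definition min_dist :: "nat \<Rightarrow> (nat \<Rightarrow> 'a::metric_space) \<Rightarrow> real" where
  "min_dist n x = Min {dist (x i) (x j) | i j. 1 \<le> i \<and> i < j \<and> j \<le> n}"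

definition tuplewise_IP_sensitive :: "nat \<Rightarrow> 'a::metric_space set \<Rightarrow> ('a \<Rightarrow> 'a) \<Rightarrow> bool" where
  "tuplewise_IP_sensitive n X T \<longleftrightarrow>
     (\<exists>\<delta>>0. \<forall>U. openin (top_of_set X) U \<and> U \<noteq> {} \<longrightarrow>
        (\<exists>x \<in> {1..n} \<rightarrow>\<^sub>E U.
           IP_set {k. k \<ge> 1 \<and> min_dist n (\<lambda>i. (T ^^ k) (x i)) > \<delta>}))"

end

theory Submission
  imports Defs
begin

text \<open>
  Given an IP-set \<open>F\<close>, the limits of the iterates \<open>T\<^sup>s\<close> along the finite sums of the tails of
  its generating sequence form a compact right topological semigroup inside the product space
  \<open>X\<^sup>X\<close>; by the Ellis--Numakura theorem it contains an idempotent \<open>u\<close>. Then \<open>u (u x) = u x\<close> says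
  that suitable \<open>T\<^sup>k\<close> with \<open>k \<in> F\<close> bring both \<open>x\<^sub>i\<close> and \<open>u x\<^sub>i\<close> close to \<open>u x\<^sub>i\<close>, so one takes
  \<open>y\<^sub>i = u x\<^sub>i\<close>. Conversely, generators of an IP-set are chosen greedily: the next one is a time \<open>p\<close>
  such that adding \<open>p\<close> to any of the finitely many sums formed so far still moves \<open>x\<^sub>i\<close> and \<open>y\<^sub>i\<close>
  near \<open>y\<^sub>i\<close>.
\<close>

subsection \<open>Idempotents in compact right topological semigroups\<close>

text \<open>Zorn's lemma yields a minimal non-empty closed subsemigroup \<open>A\<close>. For
  \<open>u\<close> in \<open>A\<close>, the set \<open>A u\<close> is again a closed subsemigroup
  inside \<open>A\<close>, so \<open>A u = A\<close> and some \<open>v\<close> in \<open>A\<close>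
  fixes \<open>u\<close> from the left. The elements of \<open>A\<close> that fix \<open>u\<close>
  in this way form one more closed subsemigroup, hence all of \<open>A\<close>, and \<open>u\<close>
  is among them. Continuity in the left factor is exactly what makes the image and the stabilizer
  closed.\<close>

lemma Ellis_Numakura:
  fixes Y :: "'b topology" and m :: "'b \<Rightarrow> 'b \<Rightarrow> 'b"
  assumes "compact_space Y" and "Hausdorff_space Y" and "topspace Y \<noteq> {}"
    and closed: "\<And>a b. a \<in> topspace Y \<Longrightarrow> b \<in> topspace Y \<Longrightarrow> m a b \<in> topspace Y"
    and assoc: "\<And>a b c. a \<in> topspace Y \<Longrightarrow> b \<in> topspace Y \<Longrightarrow> c \<in> topspace Y
                  \<Longrightarrow> m (m a b) c = m a (m b c)"
    and cont: "\<And>b. b \<in> topspace Y \<Longrightarrow> continuous_map Y Y (\<lambda>a. m a b)"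
  obtains u where "u \<in> topspace Y" and "m u u = u"
proof -
  define \<A> where "\<A> = {A. closedin Y A \<and> A \<noteq> {} \<and> (\<forall>a\<in>A. \<forall>b\<in>A. m a b \<in> A)}"
  \<comment> \<open>The order is reverse inclusion: a maximal element is a minimal set, and an upper
    bound of a chain is a set contained in all its members.\<close>
  have "\<exists>A\<in>\<A>. \<forall>B\<in>\<A>. B \<subseteq> A \<longrightarrow> B = A"
  proof (rule predicate_Zorn)
    show "partial_order_on \<A> (relation_of (\<lambda>A B. B \<subseteq> A) \<A>)"
      by (rule partial_order_on_relation_ofI) auto
    fix \<C> assume "\<C> \<in> Chains (relation_of (\<lambda>A B. B \<subseteq> A) \<A>)"
    then have sub: "\<C> \<subseteq> \<A>" and chain: "\<And>A B. A \<in> \<C> \<Longrightarrow> B \<in> \<C> \<Longrightarrow> A \<subseteq> B \<or> B \<subseteq> A"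
      by (auto simp: Chains_def relation_of_def)
    show "\<exists>U\<in>\<A>. \<forall>A\<in>\<C>. U \<subseteq> A"
    \<comment> \<open>The empty chain is treated apart because \<open>\<Inter>{}\<close> is
      \<open>UNIV\<close>; the whole space serves as its bound.\<close>
    proof (cases "\<C> = {}")
      case True
      then show ?thesis
        using assms(3) closed unfolding \<A>_def by auto
    next
      case False
      \<comment> \<open>A finite non-empty subfamily of a chain contains its own intersection, so
        the chain has the finite intersection property and compactness applies.\<close>
      have fin: "\<Inter>\<F> \<in> \<F>" if "finite \<F>" "\<F> \<noteq> {}" "\<F> \<subseteq> \<C>" for \<F>
        using Inter_in_chain[OF that(1,2), of \<C>] chain that(3)
        by (auto simp: subset_chain_def)
      have "\<Inter>\<F> \<noteq> {}" if "finite \<F>" "\<F> \<subseteq> \<C>" for \<F>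
        using fin[OF that(1) _ that(2)] sub that(2) by (cases "\<F> = {}") (auto simp: \<A>_def)
      moreover have "\<forall>C\<in>\<C>. closedin Y C"
        using sub by (auto simp: \<A>_def)
      ultimately have "\<Inter>\<C> \<noteq> {}"
        using assms(1)[unfolded compact_space_fip, rule_format, of \<C>] by simp
      moreover have "closedin Y (\<Inter>\<C>)"
        using False sub by (intro closedin_Inter) (auto simp: \<A>_def)
      ultimately have "\<Inter>\<C> \<in> \<A>"
        using sub by (auto simp: \<A>_def subset_iff)
      then show ?thesis
        by blast
    qed
  qed
  then obtain A where "A \<in> \<A>" and min: "\<And>B. B \<in> \<A> \<Longrightarrow> B \<subseteq> A \<Longrightarrow> B = A"
    by blast
  then have A: "closedin Y A" "A \<noteq> {}" "\<And>a b. a \<in> A \<Longrightarrow> b \<in> A \<Longrightarrow> m a b \<in> A"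
    by (auto simp: \<A>_def)
  have AY: "a \<in> topspace Y" if "a \<in> A" for a
    using A(1) closedin_subset that by blast
  obtain u where u: "u \<in> A"
    using A(2) by blast
  have "(\<lambda>a. m a u) ` A \<in> \<A>"
  proof -
    have "closedin Y ((\<lambda>a. m a u) ` A)"
      using closedin_compact_space[OF assms(1) A(1)] cont[OF AY[OF u]]
      by (intro compactin_imp_closedin assms(2) image_compactin[where X = Y])
    moreover have "m (m a u) (m b u) \<in> (\<lambda>a. m a u) ` A" if "a \<in> A" "b \<in> A" for a b
    proof
      show "m (m a u) (m b u) = m (m (m a u) b) u"
        using that u by (intro assoc[symmetric] closed AY)
    qed (use that u A(3) in blast)
    ultimately show ?thesis
      using A(2) by (auto simp: \<A>_def)
  qed
  then have "(\<lambda>a. m a u) ` A = A"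
    using min A(3) u by blast
  then obtain v where v: "v \<in> A" "m v u = u"
    using u by (metis imageE)
  have "{a \<in> A. m a u = u} \<in> \<A>"
  proof -
    have "closedin Y {a \<in> A. m a u \<in> {u}}"
      using A(1) AY u assms(2) cont
      by (intro closedin_continuous_map_preimage_gen[where Y = Y] closedin_Hausdorff_singleton) auto
    moreover have "m (m a b) u = u" if "a \<in> A" "b \<in> A" "m a u = u" "m b u = u" for a b
      using assoc[of a b u] that u AY by simp
    ultimately show ?thesis
      using v A(3) by (auto simp: \<A>_def)
  qed
  then have "{a \<in> A. m a u = u} = A"
    using min by blast
  then show thesis
    using that u AY by blast
qed

text \<open>A basic neighbourhood in the product topology restricts only finitely many coordinates,
  and one radius serves them all. This turns membership in the closure into an epsilon condition on
  finite sets, the form in which limits of iterates are handled below.\<close>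

lemma in_closure_of_function_space_iff:
  fixes X :: "'a::metric_space set"
  assumes "G \<subseteq> I \<rightarrow>\<^sub>E X"
  shows "f \<in> product_topology (\<lambda>_. top_of_set X) I closure_of G \<longleftrightarrow>
    f \<in> I \<rightarrow>\<^sub>E X \<and>
    (\<forall>F e. finite F \<and> F \<subseteq> I \<and> e > 0 \<longrightarrow> (\<exists>g\<in>G. \<forall>i\<in>F. dist (g i) (f i) < e))"
  (is "?L \<longleftrightarrow> ?R")
proof
  assume L: ?L
  then have f: "f \<in> I \<rightarrow>\<^sub>E X"
    by (simp add: in_closure_of)
  moreover have "\<exists>g\<in>G. \<forall>i\<in>F. dist (g i) (f i) < e" if F: "finite F" "F \<subseteq> I" "e > 0" for F e
  proof -
    define U where "U i = (if i \<in> F then X \<inter> ball (f i) e else X)" for i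
    have "openin (product_topology (\<lambda>_. top_of_set X) I) (Pi\<^sub>E I U)"
      unfolding openin_PiE_gen using F(1)
      by (auto simp: U_def intro!: finite_subset[OF _ F(1)] openin_open_Int)
    moreover have "f \<in> Pi\<^sub>E I U"
      using f F by (auto simp: U_def PiE_iff)
    ultimately obtain g where g: "g \<in> G" "g \<in> Pi\<^sub>E I U"
      using L unfolding in_closure_of by blast
    have "dist (g i) (f i) < e" if "i \<in> F" for i
      using PiE_mem[OF g(2), of i] that F(2) by (auto simp: U_def dist_commute)
    with g(1) show ?thesis
      by blast
  qed
  ultimately show ?R
    by blast
next
  assume R: ?R
  show ?L
    unfolding in_closure_of
  proof (intro conjI allI impI)
    show "f \<in> topspace (product_topology (\<lambda>_. top_of_set X) I)"
      using R by simp
    fix W assume "f \<in> W \<and> openin (product_topology (\<lambda>_. top_of_set X) I) W"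
    then obtain U where U: "finite {i \<in> I. U i \<noteq> X}" "\<And>i. i \<in> I \<Longrightarrow> openin (top_of_set X) (U i)"
      "f \<in> Pi\<^sub>E I U" "Pi\<^sub>E I U \<subseteq> W"
      unfolding openin_product_topology_alt by auto
    define F where "F = {i \<in> I. U i \<noteq> X}"
    have "\<exists>e>0. \<forall>z\<in>X. dist z (f i) < e \<longrightarrow> z \<in> U i" if "i \<in> F" for i
    proof -
      have "i \<in> I"
        using that by (simp add: F_def)
      then have "f i \<in> U i" "openin (top_of_set X) (U i)"
        using U(2,3) by auto
      then show ?thesis
        unfolding openin_euclidean_subtopology_iff by blast
    qed
    then obtain d where d: "\<And>i. i \<in> F \<Longrightarrow> d i > 0"
      "\<And>i z. i \<in> F \<Longrightarrow> z \<in> X \<Longrightarrow> dist z (f i) < d i \<Longrightarrow> z \<in> U i"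
      by metis
    \<comment> \<open>Inserting 1 keeps the minimum defined and positive when no coordinate is
      restricted.\<close>
    define e where "e = Min (insert 1 (d ` F))"
    have F: "finite F" "F \<subseteq> I"
      using U(1) by (auto simp: F_def)
    then have e: "e > 0" "\<And>i. i \<in> F \<Longrightarrow> e \<le> d i"
      using d(1) by (auto simp: e_def)
    obtain g where g: "g \<in> G" "\<And>i. i \<in> F \<Longrightarrow> dist (g i) (f i) < e"
      using conjunct2[OF R, rule_format, of F e] F e(1) by blast
    have gX: "g \<in> I \<rightarrow>\<^sub>E X"
      using g(1) assms by blast
    have "g i \<in> U i" if "i \<in> I" for i
    proof (cases "i \<in> F")
      case True
      then show ?thesis
        using d(2) g(2) e(2) gX that by (meson PiE_mem less_le_trans)
    next
      case False
      then show ?thesis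
        using gX that by (auto simp: F_def)
    qed
    then have "g \<in> Pi\<^sub>E I U"
      using gX by (auto simp: PiE_iff)
    with U(4) g(1) show "\<exists>g. g \<in> G \<and> g \<in> W"
      by blast
  qed
qed

subsection \<open>Iterates\<close>

lemma funpow_mem:
  assumes "T ` X \<subseteq> X" and "x \<in> X"
  shows "(T ^^ k) x \<in> X"
  using assms by (induction k) auto

lemma continuous_on_funpow:
  assumes "continuous_on X T" and "T ` X \<subseteq> X"
  shows "continuous_on X (T ^^ k)"
proof (induction k)
  case (Suc k)
  have "(T ^^ k) ` X \<subseteq> X"
    using funpow_mem[OF assms(2)] by blast
  with Suc assms(1) show ?case
    by (auto intro: continuous_on_compose2[of X T])
qed (simp add: id_def)

text \<open>The pointwise cluster points of \<open>T ^^ s\<close> along the sets \<open>A N\<close>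
  form a non-empty compact set \<open>S\<close>. Assumption \<open>add\<close> makes
  \<open>S\<close> a semigroup under composition: if \<open>T ^^ s\<close> approximates
  \<open>f\<close> and \<open>T ^^ t\<close> approximates \<open>g\<close> with \<open>t\<close>
  taken late enough for \<open>s\<close>, then \<open>T ^^ (s + t)\<close> approximates
  \<open>f\<close> after \<open>g\<close>. An idempotent of \<open>S\<close> is the desired
  \<open>u\<close>.\<close>

lemma idempotent_limit_of_iterates:
  fixes X :: "'a::metric_space set" and A :: "nat \<Rightarrow> nat set"
  assumes "compact X" and "X \<noteq> {}" and cont: "continuous_on X T" and TX: "T ` X \<subseteq> X"
    and "decseq A" and "\<And>N. A N \<noteq> {}"
    and add: "\<And>N. \<forall>s\<in>A N. \<exists>M. \<forall>t\<in>A M. s + t \<in> A N"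
  obtains u where "u \<in> X \<rightarrow> X" and "\<And>x. x \<in> X \<Longrightarrow> u (u x) = u x"
    and "\<And>F N e. finite F \<Longrightarrow> F \<subseteq> X \<Longrightarrow> e > 0 \<Longrightarrow> \<exists>s\<in>A N. \<forall>x\<in>F. dist ((T ^^ s) x) (u x) < e"
proof -
  define Y where "Y = product_topology (\<lambda>_::'a. top_of_set X) X"
  define G where "G N = (\<lambda>s. restrict (T ^^ s) X) ` A N" for N
  define S where "S = (\<Inter>N. Y closure_of G N)"
  have topY: "topspace Y = X \<rightarrow>\<^sub>E X"
    by (simp add: Y_def)
  have G: "G N \<subseteq> X \<rightarrow>\<^sub>E X" for N
    using funpow_mem[OF TX] by (auto simp: G_def)
  have closure_iff: "f \<in> Y closure_of G N \<longleftrightarrow> f \<in> X \<rightarrow>\<^sub>E X \<and>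
      (\<forall>F e. finite F \<and> F \<subseteq> X \<and> e > 0 \<longrightarrow> (\<exists>s\<in>A N. \<forall>x\<in>F. dist ((T ^^ s) x) (f x) < e))" for f N
    unfolding Y_def in_closure_of_function_space_iff[OF G]
    unfolding G_def by (force simp: subset_iff)
  have "compact_space Y"
    using assms(1) by (simp add: Y_def compact_space_product_topology compact_space_subtopology)
  have "Hausdorff_space Y"
    by (simp add: Y_def Hausdorff_space_product_topology Hausdorff_space_subtopology)
  have "closedin Y S"
    unfolding S_def by (intro closedin_INT) auto
  have SX: "S \<subseteq> X \<rightarrow>\<^sub>E X"
    using \<open>closedin Y S\<close> closedin_subset topY by blast
  then have topS: "topspace (subtopology Y S) = S"
    using topY by auto
  have "S \<noteq> {}"
    unfolding S_def
  proof (rule compact_space_imp_nest[OF \<open>compact_space Y\<close>])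
    show "Y closure_of G N \<noteq> {}" for N
      using closure_of_subset[of "G N" Y] G[of N] assms(6)[of N] topY by (auto simp: G_def)
    show "decseq (\<lambda>N. Y closure_of G N)"
      using \<open>decseq A\<close> unfolding decseq_def G_def
      by (meson closure_of_mono image_mono)
  qed simp
  have comp: "compose X f g \<in> S" if f: "f \<in> S" and g: "g \<in> S" for f g
  proof -
    have fX: "f \<in> X \<rightarrow>\<^sub>E X" and gX: "g \<in> X \<rightarrow>\<^sub>E X"
      using f g SX by auto
    have "\<exists>r\<in>A N. \<forall>x\<in>F. dist ((T ^^ r) x) (compose X f g x) < e"
      if F: "finite F" "F \<subseteq> X" "e > 0" for N F e
    proof -
      \<comment> \<open>The order of choices matters: \<open>s\<close> is chosen first, to
        approximate \<open>f\<close> at the points \<open>g x\<close>. Both the bound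
        \<open>M\<close> and the modulus of continuity \<open>d\<close> of \<open>T ^^ s\<close>
        depend on \<open>s\<close>, and \<open>t\<close> is chosen only afterwards.\<close>
      have gF: "finite (g ` F)" "g ` F \<subseteq> X" "e / 2 > 0"
        using F gX by (auto simp: PiE_iff)
      obtain s where s: "s \<in> A N" "\<And>x. x \<in> F \<Longrightarrow> dist ((T ^^ s) (g x)) (f (g x)) < e / 2"
        using f gF unfolding S_def INT_iff closure_iff by (metis UNIV_I imageI)
      obtain M where M: "\<And>t. t \<in> A M \<Longrightarrow> s + t \<in> A N"
        using add s(1) by blast
      have "\<exists>d>0. \<forall>z\<in>X. dist z (g x) < d \<longrightarrow> dist ((T ^^ s) z) ((T ^^ s) (g x)) < e / 2"
        if "x \<in> F" for x
        using continuous_on_funpow[OF cont TX, of s] gF(2,3) that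
        unfolding continuous_on_iff by blast
      then obtain d where d: "\<And>x. x \<in> F \<Longrightarrow> d x > 0"
        "\<And>x z. x \<in> F \<Longrightarrow> z \<in> X \<Longrightarrow> dist z (g x) < d x \<Longrightarrow>
          dist ((T ^^ s) z) ((T ^^ s) (g x)) < e / 2"
        by metis
      define d0 where "d0 = Min (insert 1 (d ` F))"
      have d0: "d0 > 0" "\<And>x. x \<in> F \<Longrightarrow> d0 \<le> d x"
        using d(1) F(1) by (auto simp: d0_def)
      obtain t where t: "t \<in> A M" "\<And>x. x \<in> F \<Longrightarrow> dist ((T ^^ t) x) (g x) < d0"
        using g F(1,2) d0(1) unfolding S_def INT_iff closure_iff by (metis UNIV_I)
      have "dist ((T ^^ (s + t)) x) (compose X f g x) < e" if x: "x \<in> F" for x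
      proof -
        have xX: "x \<in> X"
          using x F(2) by blast
        have "dist ((T ^^ s) ((T ^^ t) x)) ((T ^^ s) (g x)) < e / 2"
          using d(2)[OF x funpow_mem[OF TX xX]] t(2)[OF x] d0(2)[OF x] by simp
        then have "dist ((T ^^ s) ((T ^^ t) x)) (f (g x)) < e"
          using s(2)[OF x] dist_triangle[of _ "f (g x)" "(T ^^ s) (g x)"]
            field_sum_of_halves[of e] by (smt (verit))
        then show ?thesis
          using xX by (simp add: compose_eq funpow_add)
      qed
      with M[OF t(1)] show ?thesis
        by blast
    qed
    moreover have "compose X f g \<in> X \<rightarrow>\<^sub>E X"
      using fX gX by (auto simp: compose_def PiE_iff)
    ultimately show ?thesis
      unfolding S_def INT_iff closure_iff by blast
  qed
  obtain u where u: "u \<in> topspace (subtopology Y S)" "compose X u u = u"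
  proof (rule Ellis_Numakura[of "subtopology Y S" "compose X"])
    show "compact_space (subtopology Y S)"
      using \<open>closedin Y S\<close> \<open>compact_space Y\<close> closedin_compact_space compact_space_subtopology
      by blast
    show "Hausdorff_space (subtopology Y S)"
      using \<open>Hausdorff_space Y\<close> by (rule Hausdorff_space_subtopology)
    show "topspace (subtopology Y S) \<noteq> {}"
      using topS \<open>S \<noteq> {}\<close> by simp
    show "compose X f g \<in> topspace (subtopology Y S)"
      if "f \<in> topspace (subtopology Y S)" "g \<in> topspace (subtopology Y S)" for f g
      using comp that unfolding topS by blast
    show "compose X (compose X f g) h = compose X f (compose X g h)"
      if "f \<in> topspace (subtopology Y S)" "g \<in> topspace (subtopology Y S)"
        "h \<in> topspace (subtopology Y S)" for f g h
      using that SX unfolding topS by (fastforce simp: compose_def)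
    \<comment> \<open>Coordinate \<open>x\<close> of \<open>compose X f g\<close> is coordinate
      \<open>g x\<close> of \<open>f\<close>, so in its dependence on \<open>f\<close> it is a
      projection.\<close>
    show "continuous_map (subtopology Y S) (subtopology Y S) (\<lambda>f. compose X f g)"
      if "g \<in> topspace (subtopology Y S)" for g
    proof (rule continuous_map_into_subtopology)
      have gX: "g \<in> X \<rightarrow>\<^sub>E X" and "g \<in> S"
        using that SX unfolding topS by auto
      show "(\<lambda>f. compose X f g) \<in> topspace (subtopology Y S) \<rightarrow> S"
        using comp \<open>g \<in> S\<close> unfolding topS by blast
      have "continuous_map Y (top_of_set X) (\<lambda>f. f (g x))" if "x \<in> X" for x
        unfolding Y_def using gX that by (intro continuous_map_product_projection) auto
      then have "continuous_map Y Y (\<lambda>f. compose X f g)"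
        by (subst (2) Y_def) (auto simp: continuous_map_componentwise compose_def)
      then show "continuous_map (subtopology Y S) Y (\<lambda>f. compose X f g)"
        by (rule continuous_map_from_subtopology)
    qed
  qed
  show thesis
  proof
    show "u \<in> X \<rightarrow> X"
      using u(1) SX unfolding topS by auto
    show "u (u x) = u x" if "x \<in> X" for x
      using fun_cong[OF u(2), of x] that by (simp add: compose_def)
    show "\<exists>s\<in>A N. \<forall>x\<in>F. dist ((T ^^ s) x) (u x) < e" if "finite F" "F \<subseteq> X" "e > 0" for F N e
    proof -
      have "u \<in> Y closure_of G N"
        using u(1) unfolding topS by (simp add: S_def)
      with that show ?thesis
        unfolding closure_iff by blast
    qed
  qed
qed

subsection \<open>Product systems\<close>

lemma power_map_funpow:
  assumes "x \<in> extensional {1..n}"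
  shows "(power_map n T ^^ k) x = (\<lambda>i\<in>{1..n}. (T ^^ k) (x i))"
  using assms by (induction k) (auto simp: power_map_def extensional_restrict)

lemma limitin_power_space_iff:
  assumes "T ` X \<subseteq> X" and x: "x \<in> {1..n} \<rightarrow>\<^sub>E X" and y: "y \<in> {1..n} \<rightarrow>\<^sub>E X"
  shows "limitin (power_space n X) (\<lambda>j. (power_map n T ^^ k j) x) y F \<longleftrightarrow>
    (\<forall>i\<in>{1..n}. ((\<lambda>j. (T ^^ k j) (x i)) \<longlongrightarrow> y i) F)"
proof -
  have "(T ^^ k j) (x i) \<in> X" "y i \<in> X" if "i \<in> {1..n}" for i j
    using funpow_mem[OF assms(1)] x y that by (auto simp: PiE_iff)
  then show ?thesis
    using x y unfolding power_space_def
    by (auto simp: limitin_componentwise power_map_funpow PiE_iff limitin_subtopology)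
qed

text \<open>Convergence in the product is coordinatewise, but a single sequence of times
  \<open>k\<close> has to serve all coordinates of both tuples.\<close>

lemma strongly_proximal_power_iff:
  assumes "T ` X \<subseteq> X" and x: "x \<in> {1..n} \<rightarrow>\<^sub>E X" and y: "y \<in> {1..n} \<rightarrow>\<^sub>E X"
  shows "strongly_proximal (power_space n X) (power_map n T) x y \<longleftrightarrow>
    (\<exists>k. filterlim k at_top sequentially \<and>
      (\<forall>i\<in>{1..n}. (\<lambda>j. (T ^^ k j) (x i)) \<longlonglongrightarrow> y i \<and> (\<lambda>j. (T ^^ k j) (y i)) \<longlonglongrightarrow> y i))"
proof -
  have "(map_prod (power_map n T) (power_map n T) ^^ k) (x, y) =
      ((power_map n T ^^ k) x, (power_map n T ^^ k) y)" for k
    by (induction k) auto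
  then show ?thesis
    unfolding strongly_proximal_def omega_limit_set_def
    by (simp add: limitin_pairwise o_def limitin_power_space_iff[OF assms(1) x y]
        limitin_power_space_iff[OF assms(1) y y] ball_conj_distrib)
qed

section \<open>Separation of tuples through pairwise distances\<close>

lemma min_dist_set:
  assumes "n \<ge> 2"
  shows "finite {dist (x i) (x j) | i j. 1 \<le> i \<and> i < j \<and> j \<le> n}"
    and "{dist (x i) (x j) | i j. 1 \<le> i \<and> i < j \<and> j \<le> (n::nat)} \<noteq> {}"
proof -
  have "{dist (x i) (x j) | i j. 1 \<le> i \<and> i < j \<and> j \<le> n}
      \<subseteq> (\<lambda>(i, j). dist (x i) (x j)) ` ({..n} \<times> {..n})"
    by force
  then show "finite {dist (x i) (x j) | i j. 1 \<le> i \<and> i < j \<and> j \<le> n}"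
    by (rule finite_subset) simp
  have "dist (x 1) (x 2) \<in> {dist (x i) (x j) | i j. 1 \<le> i \<and> i < j \<and> j \<le> n}"
    using assms by force
  then show "{dist (x i) (x j) | i j. 1 \<le> i \<and> i < j \<and> j \<le> n} \<noteq> {}"
    by blast
qed

lemma less_min_dist_iff:
  assumes "n \<ge> 2"
  shows "\<delta> < min_dist n x \<longleftrightarrow> (\<forall>i j. 1 \<le> i \<and> i < j \<and> j \<le> n \<longrightarrow> \<delta> < dist (x i) (x j))"
  unfolding min_dist_def Min_gr_iff[OF min_dist_set[OF assms]] by blast

lemma le_min_dist_iff:
  assumes "n \<ge> 2"
  shows "\<delta> \<le> min_dist n x \<longleftrightarrow> (\<forall>i j. 1 \<le> i \<and> i < j \<and> j \<le> n \<longrightarrow> \<delta> \<le> dist (x i) (x j))"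
  unfolding min_dist_def Min_ge_iff[OF min_dist_set[OF assms]] by blast

subsection \<open>IP-sets of return times\<close>

text \<open>By continuity of \<open>T ^^ s\<close>, the points \<open>(T ^^ (s + k j)) z\<close>
  tend to \<open>(T ^^ s) (y i)\<close> for \<open>z = x i\<close> and for \<open>z = y i\<close>.
  That limit lies in the open \<open>e\<close>-ball around \<open>y i\<close>, so each condition
  holds eventually in \<open>j\<close>, and finitely many hold at once.\<close>

lemma exists_return_time:
  fixes x y :: "'i \<Rightarrow> 'a::metric_space"
  assumes cont: "continuous_on X T" and TX: "T ` X \<subseteq> X"
    and I: "finite I" "\<And>i. i \<in> I \<Longrightarrow> x i \<in> X" "\<And>i. i \<in> I \<Longrightarrow> y i \<in> X"
    and k: "filterlim k at_top sequentially"
      "\<And>i. i \<in> I \<Longrightarrow> (\<lambda>j. (T ^^ k j) (x i)) \<longlonglongrightarrow> y i"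
      "\<And>i. i \<in> I \<Longrightarrow> (\<lambda>j. (T ^^ k j) (y i)) \<longlonglongrightarrow> y i"
    and R: "finite R" "\<And>s i. s \<in> R \<Longrightarrow> i \<in> I \<Longrightarrow> dist ((T ^^ s) (y i)) (y i) < e"
  shows "\<exists>p\<ge>1. \<forall>s\<in>R. \<forall>i\<in>I.
    dist ((T ^^ (s + p)) (x i)) (y i) < e \<and> dist ((T ^^ (s + p)) (y i)) (y i) < e"
proof -
  have ev: "\<forall>\<^sub>F j in sequentially. dist ((T ^^ (s + k j)) z) (y i) < e"
    if "s \<in> R" "i \<in> I" "z \<in> X" and lim: "(\<lambda>j. (T ^^ k j) z) \<longlonglongrightarrow> y i" for s i z
  proof -
    have "(\<lambda>j. (T ^^ s) ((T ^^ k j) z)) \<longlonglongrightarrow> (T ^^ s) (y i)"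
      using continuous_on_funpow[OF cont TX] lim I(3)[OF that(2)]
      by (rule continuous_on_tendsto_compose) (simp add: funpow_mem[OF TX that(3)])
    then have "(\<lambda>j. dist ((T ^^ s) ((T ^^ k j) z)) (y i)) \<longlonglongrightarrow> dist ((T ^^ s) (y i)) (y i)"
      by (intro tendsto_intros)
    from order_tendstoD(2)[OF this R(2)[OF that(1,2)]] show ?thesis
      by (simp add: funpow_add)
  qed
  have "\<forall>\<^sub>F j in sequentially. k j \<ge> 1"
    using k(1) by (simp add: filterlim_at_top)
  moreover have "\<forall>\<^sub>F j in sequentially. \<forall>s\<in>R. \<forall>i\<in>I. dist ((T ^^ (s + k j)) (x i)) (y i) < e"
    using R(1) I k(2) by (intro eventually_ball_finite ballI ev) auto
  moreover have "\<forall>\<^sub>F j in sequentially. \<forall>s\<in>R. \<forall>i\<in>I. dist ((T ^^ (s + k j)) (y i)) (y i) < e"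
    using R(1) I k(3) by (intro eventually_ball_finite ballI ev) auto
  ultimately have "\<forall>\<^sub>F j in sequentially. k j \<ge> 1 \<and>
      (\<forall>s\<in>R. \<forall>i\<in>I. dist ((T ^^ (s + k j)) (x i)) (y i) < e) \<and>
      (\<forall>s\<in>R. \<forall>i\<in>I. dist ((T ^^ (s + k j)) (y i)) (y i) < e)"
    by eventually_elim auto
  then obtain j where "k j \<ge> 1"
      "\<forall>s\<in>R. \<forall>i\<in>I. dist ((T ^^ (s + k j)) (x i)) (y i) < e"
      "\<forall>s\<in>R. \<forall>i\<in>I. dist ((T ^^ (s + k j)) (y i)) (y i) < e"
    by (auto simp: eventually_sequentially)
  then show ?thesis
    by blast
qed

text \<open>The generators are built recursively. \<open>R m\<close> collects the sums of the first
  \<open>m\<close> generators, and the next one is a return time that works after every shift in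
  \<open>R m\<close>.\<close>

lemma exists_IP_return_times:
  fixes x y :: "'i \<Rightarrow> 'a::metric_space"
  assumes cont: "continuous_on X T" and TX: "T ` X \<subseteq> X"
    and I: "finite I" "\<And>i. i \<in> I \<Longrightarrow> x i \<in> X" "\<And>i. i \<in> I \<Longrightarrow> y i \<in> X"
    and k: "filterlim k at_top sequentially"
      "\<And>i. i \<in> I \<Longrightarrow> (\<lambda>j. (T ^^ k j) (x i)) \<longlonglongrightarrow> y i"
      "\<And>i. i \<in> I \<Longrightarrow> (\<lambda>j. (T ^^ k j) (y i)) \<longlonglongrightarrow> y i"
    and "e > 0"
  obtains p :: "nat \<Rightarrow> nat" where "\<And>m. p m \<ge> 1"
    and "\<And>\<alpha> i. finite \<alpha> \<Longrightarrow> \<alpha> \<noteq> {} \<Longrightarrow> i \<in> I \<Longrightarrow> dist ((T ^^ sum p \<alpha>) (x i)) (y i) < e"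
proof -
  \<comment> \<open>The invariant concerns only the points \<open>y i\<close>: the empty sum 0
    belongs to every \<open>R m\<close>, and at time 0 the point \<open>x i\<close> may be far from
    \<open>y i\<close>. Returns of the \<open>y i\<close> are all that the next choice
    requires.\<close>
  define good where "good R \<longleftrightarrow> finite R \<and>
    (\<forall>s\<in>R. \<forall>i\<in>I. dist ((T ^^ s) (y i)) (y i) < e)" for R
  have "\<exists>p\<ge>1. \<forall>s\<in>R. \<forall>i\<in>I.
      dist ((T ^^ (s + p)) (x i)) (y i) < e \<and> dist ((T ^^ (s + p)) (y i)) (y i) < e"
    if "good R" for R
    using that I k unfolding good_def by (intro exists_return_time[OF cont TX, of I x y k R e]) auto
  then obtain q where q: "\<And>R. good R \<Longrightarrow> q R \<ge> 1"
    "\<And>R s i. good R \<Longrightarrow> s \<in> R \<Longrightarrow> i \<in> I \<Longrightarrow> dist ((T ^^ (s + q R)) (x i)) (y i) < e"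
    "\<And>R s i. good R \<Longrightarrow> s \<in> R \<Longrightarrow> i \<in> I \<Longrightarrow> dist ((T ^^ (s + q R)) (y i)) (y i) < e"
    by metis
  define R where "R = rec_nat {0} (\<lambda>_ R. R \<union> (\<lambda>s. s + q R) ` R)"
  define p where "p m = q (R m)" for m
  have R_0: "R 0 = {0}" and R_Suc: "R (Suc m) = R m \<union> (\<lambda>s. s + p m) ` R m" for m
    by (simp_all add: R_def p_def)
  have good: "good (R m)" for m
  proof (induction m)
    case 0
    then show ?case
      using \<open>e > 0\<close> by (simp add: good_def R_0)
  next
    case (Suc m)
    then show ?case
      using q(3)[OF Suc] by (auto simp: good_def R_Suc p_def)
  qed
  have sums: "\<alpha> \<subseteq> {..<m} \<Longrightarrow> sum p \<alpha> \<in> R m" for \<alpha> m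
  proof (induction m arbitrary: \<alpha>)
    case 0
    then show ?case
      by (simp add: R_0)
  next
    case (Suc m)
    have rest: "sum p (\<alpha> - {m}) \<in> R m"
      using Suc.prems by (intro Suc.IH) auto
    have "finite \<alpha>"
      using Suc.prems finite_subset by blast
    then show ?case
      using rest by (cases "m \<in> \<alpha>") (auto simp: R_Suc sum.remove add.commute)
  qed
  show thesis
  proof
    show "p m \<ge> 1" for m
      using q(1)[OF good] by (simp add: p_def)
    show "dist ((T ^^ sum p \<alpha>) (x i)) (y i) < e" if "finite \<alpha>" "\<alpha> \<noteq> {}" "i \<in> I" for \<alpha> i
    proof -
      \<comment> \<open>Splitting off the largest index writes the sum as an element of
        \<open>R m\<close> plus the generator chosen for \<open>R m\<close>; that choice controls
        the orbit of \<open>x i\<close>.\<close>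
      define m where "m = Max \<alpha>"
      have "m \<in> \<alpha>" and "\<alpha> - {m} \<subseteq> {..<m}"
        using that(1,2) by (auto simp: m_def less_le)
      then have "sum p \<alpha> = sum p (\<alpha> - {m}) + q (R m)" "sum p (\<alpha> - {m}) \<in> R m"
        using that(1) sums by (auto simp: sum.remove p_def)
      then show ?thesis
        using q(2)[OF good _ that(3)] by simp
    qed
  qed
qed

text \<open>On a finite set, the idempotent obtained from the tails of an IP-set is reached along a
  genuine sequence of times in \<open>F\<close>, which is the form that strong proximality asks
  for.\<close>

lemma IP_set_common_limit:
  fixes X :: "'a::metric_space set"
  assumes "compact X" and "X \<noteq> {}" and "continuous_on X T" and "T ` X \<subseteq> X"
    and "IP_set F" and "finite Z" and "Z \<subseteq> X"
  obtains u k where "u \<in> X \<rightarrow> X" and "filterlim k at_top sequentially" and "\<And>j. k j \<in> F"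
    and "\<And>z. z \<in> Z \<Longrightarrow> (\<lambda>j. (T ^^ k j) z) \<longlonglongrightarrow> u z"
    and "\<And>z. z \<in> Z \<Longrightarrow> (\<lambda>j. (T ^^ k j) (u z)) \<longlonglongrightarrow> u z"
proof -
  obtain p :: "nat \<Rightarrow> nat" where p: "\<forall>i\<ge>1. p i \<ge> 1"
    and pF: "\<forall>\<alpha>. finite \<alpha> \<and> \<alpha> \<noteq> {} \<and> \<alpha> \<subseteq> {1..} \<longrightarrow> sum p \<alpha> \<in> F"
    using assms(5) unfolding IP_set_def by auto
  \<comment> \<open>Starting at \<open>Suc N\<close> keeps the indices in \<open>{1..}\<close>,
    where \<open>p\<close> is positive. The bound \<open>N \<le> sum p \<alpha>\<close> later forces
    the chosen times to infinity.\<close>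
  define A where "A N = {sum p \<alpha> | \<alpha>. finite \<alpha> \<and> \<alpha> \<noteq> {} \<and> \<alpha> \<subseteq> {Suc N..} \<and> N \<le> sum p \<alpha>}" for N
  have "decseq A"
  proof (rule decseq_SucI)
    show "A (Suc N) \<subseteq> A N" for N
      unfolding A_def using Suc_leD atLeast_subset_iff[of "Suc (Suc N)" "Suc N"]
      by (intro Collect_mono) (metis lessI less_imp_le subset_trans)
  qed
  have "A N \<noteq> {}" for N
  proof -
    \<comment> \<open>The \<open>N + 1\<close> summands are each at least 1, so the sum exceeds
      \<open>N\<close>.\<close>
    have "of_nat (card {Suc N..Suc N + N}) * 1 \<le> sum p {Suc N..Suc N + N}"
      by (rule sum_bounded_below) (use p in auto)
    then have "sum p {Suc N..Suc N + N} \<in> A N"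
      unfolding A_def by (intro CollectI exI[of _ "{Suc N..Suc N + N}"]) auto
    then show ?thesis
      by blast
  qed
  have add: "\<forall>s\<in>A N. \<exists>M. \<forall>t\<in>A M. s + t \<in> A N" for N
  proof
    fix s assume s: "s \<in> A N"
    obtain \<alpha> where \<alpha>: "s = sum p \<alpha>" "finite \<alpha>" "\<alpha> \<noteq> {}" "\<alpha> \<subseteq> {Suc N..}" "N \<le> s"
      using s unfolding A_def by blast
    \<comment> \<open>Indices beyond \<open>Max \<alpha>\<close> are disjoint from
      \<open>\<alpha>\<close>, so the two sums add up to the sum over the union.\<close>
    have "s + t \<in> A N" if t: "t \<in> A (Max \<alpha>)" for t
    proof -
      obtain \<beta> where \<beta>: "t = sum p \<beta>" "finite \<beta>" "\<beta> \<subseteq> {Suc (Max \<alpha>)..}"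
        using t unfolding A_def by blast
      have "a < b" if "a \<in> \<alpha>" "b \<in> \<beta>" for a b
        using Max_ge[OF \<alpha>(2) that(1)] \<beta>(3) that(2) by fastforce
      then have disj: "\<alpha> \<inter> \<beta> = {}" and "\<beta> \<subseteq> {Suc N..}"
        using \<alpha>(3,4) by fastforce+
      then show ?thesis
        unfolding A_def using \<alpha> \<beta>
        by (intro CollectI exI[of _ "\<alpha> \<union> \<beta>"]) (auto simp: sum.union_disjoint)
    qed
    then show "\<exists>M. \<forall>t\<in>A M. s + t \<in> A N"
      by blast
  qed
  obtain u where u: "u \<in> X \<rightarrow> X" "\<And>x. x \<in> X \<Longrightarrow> u (u x) = u x"
    and approx: "\<And>F N e. finite F \<Longrightarrow> F \<subseteq> X \<Longrightarrow> e > 0 \<Longrightarrow>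
      \<exists>s\<in>A N. \<forall>x\<in>F. dist ((T ^^ s) x) (u x) < e"
    by (rule idempotent_limit_of_iterates[OF assms(1-4) \<open>decseq A\<close> \<open>\<And>N. A N \<noteq> {}\<close> add])
      (rule that)
  \<comment> \<open>The images under \<open>u\<close> are included so that one sequence handles both
    \<open>z\<close> and \<open>u z\<close>; at \<open>u z\<close> the limit is
    \<open>u (u z) = u z\<close>.\<close>
  define W where "W = Z \<union> u ` Z"
  have W: "finite W" "W \<subseteq> X"
    using assms(6,7) u(1) by (auto simp: W_def)
  have "\<exists>s\<in>A j. \<forall>x\<in>W. dist ((T ^^ s) x) (u x) < inverse (real (Suc j))" for j
    using approx[OF W] by simp
  then obtain k where k: "\<And>j. k j \<in> A j"
    "\<And>j x. x \<in> W \<Longrightarrow> dist ((T ^^ k j) x) (u x) < inverse (real (Suc j))"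
    by metis
  have lim: "(\<lambda>j. (T ^^ k j) x) \<longlonglongrightarrow> u x" if "x \<in> W" for x
  proof -
    have "\<forall>j. norm (dist ((T ^^ k j) x) (u x)) \<le> inverse (real (Suc j))"
      using k(2)[OF that] by (simp add: less_imp_le del: of_nat_Suc)
    then have "(\<lambda>j. dist ((T ^^ k j) x) (u x)) \<longlonglongrightarrow> 0"
      by (rule Lim_null_comparison[OF always_eventually LIMSEQ_inverse_real_of_nat])
    then show ?thesis
      by (rule tendsto_dist_iff[THEN iffD2])
  qed
  show thesis
  proof
    show "filterlim k at_top sequentially"
    proof (rule filterlim_at_top_mono[OF filterlim_ident always_eventually], rule allI)
      show "j \<le> k j" for j
        using k(1)[of j] by (auto simp: A_def)
    qed
    show "k j \<in> F" for j
      using k(1)[of j] pF unfolding A_def by fastforce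
    show "(\<lambda>j. (T ^^ k j) z) \<longlonglongrightarrow> u z" if "z \<in> Z" for z
      using lim[of z] that by (simp add: W_def)
    show "(\<lambda>j. (T ^^ k j) (u z)) \<longlonglongrightarrow> u z" if "z \<in> Z" for z
      using lim[of "u z"] u(2)[of z] assms(7) that by (auto simp: W_def)
  qed (rule u(1))
qed

section \<open>The two implications of the characterization\<close>

theorem proposition3p1:
  fixes X :: "'a::metric_space set" and T :: "'a \<Rightarrow> 'a" and n :: nat
  assumes "dynamical_system X T" and "n \<ge> 2"
  shows "tuplewise_IP_sensitive n X T \<longleftrightarrow>
    (\<exists>\<delta>>0. \<forall>U. openin (top_of_set X) U \<and> U \<noteq> {} \<longrightarrow>
       (\<exists>x \<in> {1..n} \<rightarrow>\<^sub>E U. \<exists>y \<in> {1..n} \<rightarrow>\<^sub>E X.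
          min_dist n y \<ge> \<delta> \<and>
          strongly_proximal (power_space n X) (power_map n T) x y))"
proof -
  have X: "compact X" and cont: "continuous_on X T" and TX: "T ` X \<subseteq> X"
    using assms(1) by (auto simp: dynamical_system_def)
  have forward: "\<exists>y \<in> {1..n} \<rightarrow>\<^sub>E X. min_dist n y \<ge> \<delta> \<and>
      strongly_proximal (power_space n X) (power_map n T) x y"
    if x: "x \<in> {1..n} \<rightarrow>\<^sub>E X"
      and IP: "IP_set {k. k \<ge> 1 \<and> min_dist n (\<lambda>i. (T ^^ k) (x i)) > \<delta>}" for x \<delta>
  proof -
    have xX: "x ` {1..n} \<subseteq> X"
      using x by auto
    then have "X \<noteq> {}"
      using assms(2) by auto
    obtain u k where u: "u \<in> X \<rightarrow> X" and k: "filterlim k at_top sequentially"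
      "\<And>j. k j \<in> {k. k \<ge> 1 \<and> min_dist n (\<lambda>i. (T ^^ k) (x i)) > \<delta>}"
      and lim: "\<And>z. z \<in> x ` {1..n} \<Longrightarrow> (\<lambda>j. (T ^^ k j) z) \<longlonglongrightarrow> u z"
        "\<And>z. z \<in> x ` {1..n} \<Longrightarrow> (\<lambda>j. (T ^^ k j) (u z)) \<longlonglongrightarrow> u z"
      by (rule IP_set_common_limit
          [OF X \<open>X \<noteq> {}\<close> cont TX IP finite_imageI[OF finite_atLeastAtMost] xX])
        (rule that)
    define y where "y = (\<lambda>i\<in>{1..n}. u (x i))"
    have y: "y \<in> {1..n} \<rightarrow>\<^sub>E X"
      using u xX by (auto simp: y_def)
    \<comment> \<open>All times \<open>k l\<close> lie in the IP-set, where the distances exceed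
      \<open>\<delta>\<close>. In the limit the strict bound becomes a weak one with the same
      constant.\<close>
    have "\<delta> \<le> dist (y i) (y j)" if ij: "1 \<le> i" "i < j" "j \<le> n" for i j
    proof (rule tendsto_lowerbound)
      show "(\<lambda>l. dist ((T ^^ k l) (x i)) ((T ^^ k l) (x j))) \<longlonglongrightarrow> dist (y i) (y j)"
        using ij by (auto simp: y_def intro!: tendsto_dist lim(1))
      show "\<forall>\<^sub>F l in sequentially. \<delta> \<le> dist ((T ^^ k l) (x i)) ((T ^^ k l) (x j))"
        using k(2) ij by (auto simp: less_min_dist_iff[OF assms(2)] intro!: always_eventually less_imp_le)
    qed simp
    moreover have "strongly_proximal (power_space n X) (power_map n T) x y"
      unfolding strongly_proximal_power_iff[OF TX x y]
      using k(1) lim by (auto simp: y_def intro!: exI[of _ k])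
    ultimately show ?thesis
      using y le_min_dist_iff[OF assms(2)] by blast
  qed
  \<comment> \<open>Moving each of two points by less than \<open>\<delta> / 4\<close> from
    \<open>y i\<close> and \<open>y j\<close> costs less than \<open>\<delta> / 2\<close> of their
    distance, which leaves a strict bound \<open>\<delta> / 2\<close>.\<close>
  have backward: "IP_set {k. k \<ge> 1 \<and> min_dist n (\<lambda>i. (T ^^ k) (x i)) > \<delta> / 2}"
    if x: "x \<in> {1..n} \<rightarrow>\<^sub>E X" and y: "y \<in> {1..n} \<rightarrow>\<^sub>E X"
      and \<delta>: "\<delta> > 0" "min_dist n y \<ge> \<delta>"
      and prox: "strongly_proximal (power_space n X) (power_map n T) x y" for x y \<delta>
  proof -
    obtain k where k: "filterlim k at_top sequentially"
      "\<And>i. i \<in> {1..n} \<Longrightarrow> (\<lambda>j. (T ^^ k j) (x i)) \<longlonglongrightarrow> y i"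
      "\<And>i. i \<in> {1..n} \<Longrightarrow> (\<lambda>j. (T ^^ k j) (y i)) \<longlonglongrightarrow> y i"
      using prox unfolding strongly_proximal_power_iff[OF TX x y] by blast
    obtain p :: "nat \<Rightarrow> nat" where p: "\<And>m. p m \<ge> 1"
      and near: "\<And>\<alpha> i. finite \<alpha> \<Longrightarrow> \<alpha> \<noteq> {} \<Longrightarrow> i \<in> {1..n} \<Longrightarrow>
        dist ((T ^^ sum p \<alpha>) (x i)) (y i) < \<delta> / 4"
      using exists_IP_return_times[OF cont TX, of "{1..n}" x y k "\<delta> / 4"] k x y \<delta>(1)
      by (auto simp: PiE_iff)
    have "sum p \<alpha> \<in> {k. k \<ge> 1 \<and> min_dist n (\<lambda>i. (T ^^ k) (x i)) > \<delta> / 2}"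
      if \<alpha>: "finite \<alpha>" "\<alpha> \<noteq> {}" for \<alpha>
    proof -
      have "1 \<le> sum p \<alpha>"
      proof -
        obtain a where "a \<in> \<alpha>"
          using \<alpha>(2) by blast
        then show ?thesis
          using member_le_sum[of a \<alpha> p] p[of a] \<alpha>(1) by simp
      qed
      moreover have "\<delta> / 2 < dist ((T ^^ sum p \<alpha>) (x i)) ((T ^^ sum p \<alpha>) (x j))"
        if ij: "1 \<le> i" "i < j" "j \<le> n" for i j
      proof -
        define a b where "a = (T ^^ sum p \<alpha>) (x i)" and "b = (T ^^ sum p \<alpha>) (x j)"
        have "\<delta> \<le> dist (y i) (y j)"
          using \<delta>(2) ij by (simp add: le_min_dist_iff[OF assms(2)])
        moreover have "dist a (y i) < \<delta> / 4" "dist b (y j) < \<delta> / 4"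
          using near[OF \<alpha>] ij by (simp_all add: a_def b_def)
        ultimately have "\<delta> / 2 < dist a b"
          by metric
        then show ?thesis
          by (simp add: a_def b_def)
      qed
      ultimately show ?thesis
        by (simp add: less_min_dist_iff[OF assms(2)])
    qed
    then show ?thesis
      unfolding IP_set_def using p by (intro conjI exI[of _ p]) auto
  qed
  have UX: "x \<in> {1..n} \<rightarrow>\<^sub>E X" if "openin (top_of_set X) U" "x \<in> {1..n} \<rightarrow>\<^sub>E U" for x U
    using that openin_imp_subset by fastforce
  show ?thesis
  proof
    assume "tuplewise_IP_sensitive n X T"
    then obtain \<delta> where "\<delta> > 0" and \<delta>: "\<And>U. openin (top_of_set X) U \<Longrightarrow> U \<noteq> {} \<Longrightarrow>
        \<exists>x \<in> {1..n} \<rightarrow>\<^sub>E U. IP_set {k. k \<ge> 1 \<and> min_dist n (\<lambda>i. (T ^^ k) (x i)) > \<delta>}"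
      unfolding tuplewise_IP_sensitive_def by blast
    show "\<exists>\<delta>>0. \<forall>U. openin (top_of_set X) U \<and> U \<noteq> {} \<longrightarrow>
       (\<exists>x \<in> {1..n} \<rightarrow>\<^sub>E U. \<exists>y \<in> {1..n} \<rightarrow>\<^sub>E X.
          min_dist n y \<ge> \<delta> \<and>
          strongly_proximal (power_space n X) (power_map n T) x y)"
    proof (intro exI[of _ \<delta>] conjI allI impI)
      fix U assume U: "openin (top_of_set X) U \<and> U \<noteq> {}"
      then obtain x where x: "x \<in> {1..n} \<rightarrow>\<^sub>E U"
        "IP_set {k. k \<ge> 1 \<and> min_dist n (\<lambda>i. (T ^^ k) (x i)) > \<delta>}"
        using \<delta> by blast
      show "\<exists>x \<in> {1..n} \<rightarrow>\<^sub>E U. \<exists>y \<in> {1..n} \<rightarrow>\<^sub>E X. min_dist n y \<ge> \<delta> \<and>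
          strongly_proximal (power_space n X) (power_map n T) x y"
        using forward[OF UX[OF conjunct1[OF U] x(1)] x(2)] x(1) by (rule bexI)
    qed (rule \<open>\<delta> > 0\<close>)
  next
    assume "\<exists>\<delta>>0. \<forall>U. openin (top_of_set X) U \<and> U \<noteq> {} \<longrightarrow>
       (\<exists>x \<in> {1..n} \<rightarrow>\<^sub>E U. \<exists>y \<in> {1..n} \<rightarrow>\<^sub>E X.
          min_dist n y \<ge> \<delta> \<and>
          strongly_proximal (power_space n X) (power_map n T) x y)"
    then obtain \<delta> where "\<delta> > 0" and \<delta>: "\<And>U. openin (top_of_set X) U \<Longrightarrow> U \<noteq> {} \<Longrightarrow>
        \<exists>x \<in> {1..n} \<rightarrow>\<^sub>E U. \<exists>y \<in> {1..n} \<rightarrow>\<^sub>E X. min_dist n y \<ge> \<delta> \<and>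
          strongly_proximal (power_space n X) (power_map n T) x y"
      by blast
    show "tuplewise_IP_sensitive n X T"
      unfolding tuplewise_IP_sensitive_def
    proof (intro exI[of _ "\<delta> / 2"] conjI allI impI)
      fix U assume U: "openin (top_of_set X) U \<and> U \<noteq> {}"
      then obtain x y where x: "x \<in> {1..n} \<rightarrow>\<^sub>E U" and y: "y \<in> {1..n} \<rightarrow>\<^sub>E X"
        "min_dist n y \<ge> \<delta>" "strongly_proximal (power_space n X) (power_map n T) x y"
        using \<delta> by blast
      then show "\<exists>x \<in> {1..n} \<rightarrow>\<^sub>E U.
          IP_set {k. k \<ge> 1 \<and> min_dist n (\<lambda>i. (T ^^ k) (x i)) > \<delta> / 2}"
        using backward[OF UX[OF conjunct1[OF U] x] y(1) \<open>\<delta> > 0\<close> y(2,3)] by blast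
    qed (use \<open>\<delta> > 0\<close> in simp)
  qed
qed

end
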